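(* Let $\rhd$ be a system of ideals for an ordered monoid $G$, and let $S$ be the meet-semilattice generated by the single-conclusion entailment relation $\rhd$, with natural order-preserving map $G\to S$. Then there is a unique monoid law on $S$ which is compatible with its semilattice structure (i.e. $x+(y\wedge z)=(x+y)\wedge(x+z)$) and such that the natural map $G\to S$ is a monoid morphism.
   Context: Monoids are commutative. An ordered monoid is a commutative monoid $(G,+,0)$ with a partial order $\le_G$ such that $x\le_G y$ implies $x+z\le_G y+z$. A meet-semilattice here is a set with an idempotent, commutative, associative law $\wedge$ (no greatest element required). $\mathrm{P}_{\mathrm{fe}}^*(G)$ is the set of nonempty finite subsets of $G$; $a$ stands for $\{a\}$, $A,A'$ for $A\cup A'$, $x+A=\{x+a:a\in A\}$. A single-conclusion entailment relation on $G$ is a relation $\rhd$ between $\mathrm{P}_{\mathrm{fe}}^*(G)$ and $G$ such that $a\rhd a$; $A\rhd b\Rightarrow A,A'\rhd b$; ($A\rhd c$ and $A,c\rhd b$) $\Rightarrow A\rhd b$. It is a system of ideals for the ordered monoid $G$ if moreover $a\le_G b\Rightarrow a\rhd b$ and $A\rhd b\Rightarrow x+A\rhd x+b$ for all $x\in G$. The meet-semilattice generated by $\rhd$ is the meet-semilattice presented by generators the elements of $G$ and relations $\bigwedge A\le b$ whenever $A\rhd b$; equivalently it is the quotient of $\mathrm{P}_{\mathrm{fe}}^*(G)$ by the preorder $A\le_\rhd B$ iff $A\rhd b$ for all $b\in B$, with meet induced by union. *)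

theory Defs
  imports "HOL-Algebra.Group" "HOL-Library.FuncSet"
begin

definition Pfe :: "'a set set" where
  "Pfe = {A. finite A \<and> A \<noteq> {}}"

text \<open>
  A relation between \<open>Pfe\<close> and \<open>G\<close> is encoded as a predicate on arbitrary sets which is
  required to be false outside \<open>Pfe\<close>.
\<close>

locale single_conclusion_entailment =
  fixes ent :: "'a set \<Rightarrow> 'a \<Rightarrow> bool"  (infix \<open>\<rhd>\<close> 50)
  assumes ent_Pfe: "A \<rhd> b \<Longrightarrow> A \<in> Pfe"
    and ent_refl: "{a} \<rhd> a"
    and ent_mono: "A \<rhd> b \<Longrightarrow> A' \<in> Pfe \<Longrightarrow> A \<union> A' \<rhd> b"
    and ent_cut: "A \<rhd> c \<Longrightarrow> A \<union> {c} \<rhd> b \<Longrightarrow> A \<rhd> b"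

locale system_of_ideals = single_conclusion_entailment ent
  for ent :: "'a :: ordered_comm_monoid_add set \<Rightarrow> 'a \<Rightarrow> bool"  (infix \<open>\<rhd>\<close> 50) +
  assumes ent_order: "a \<le> b \<Longrightarrow> {a} \<rhd> b"
    and ent_translate: "A \<rhd> b \<Longrightarrow> (\<lambda>a. x + a) ` A \<rhd> x + b"

definition ent_le :: "('a set \<Rightarrow> 'a \<Rightarrow> bool) \<Rightarrow> 'a set \<Rightarrow> 'a set \<Rightarrow> bool" where
  "ent_le ent A B \<longleftrightarrow> (\<forall>b\<in>B. ent A b)"

definition ent_eq :: "('a set \<Rightarrow> 'a \<Rightarrow> bool) \<Rightarrow> ('a set \<times> 'a set) set" where
  "ent_eq ent = {(A, B). A \<in> Pfe \<and> B \<in> Pfe \<and> ent_le ent A B \<and> ent_le ent B A}"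

definition gen_semilattice :: "('a set \<Rightarrow> 'a \<Rightarrow> bool) \<Rightarrow> 'a set set set" where
  "gen_semilattice ent = Pfe // ent_eq ent"

definition nat_map :: "('a set \<Rightarrow> 'a \<Rightarrow> bool) \<Rightarrow> 'a \<Rightarrow> 'a set set" where
  "nat_map ent a = ent_eq ent `` {{a}}"

text \<open>
  All the classes in the following union coincide when \<open>X\<close> and \<open>Y\<close> lie in the quotient
  (lemma \<open>gen_meet_class\<close> below).
\<close>

definition gen_meet ::
    "('a set \<Rightarrow> 'a \<Rightarrow> bool) \<Rightarrow> 'a set set \<Rightarrow> 'a set set \<Rightarrow> 'a set set" where
  "gen_meet ent X Y = (\<Union>A\<in>X. \<Union>B\<in>Y. ent_eq ent `` {A \<union> B})"


subsection \<open>The quotient is the meet-semilattice presented by the entailment relation\<close>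

context single_conclusion_entailment
begin

lemma ent_superset: "A \<rhd> b \<Longrightarrow> A \<subseteq> B \<Longrightarrow> B \<in> Pfe \<Longrightarrow> B \<rhd> b"
  using ent_mono[of A b B] by (simp add: sup.absorb2)

lemma ent_mem: "A \<in> Pfe \<Longrightarrow> a \<in> A \<Longrightarrow> A \<rhd> a"
  using ent_superset[OF ent_refl, of a A] by simp

lemma ent_cut_set:
  assumes "ent_le ent A B" "B \<in> Pfe" "B \<rhd> c"
  shows "A \<rhd> c"
proof -
  have A: "A \<in> Pfe"
    using assms(1,2) ent_Pfe by (auto simp: ent_le_def Pfe_def)
  have "A \<union> C \<rhd> c \<Longrightarrow> A \<rhd> c" if "finite C" "C \<subseteq> B" for C
    using that
  proof (induction C rule: finite_induct)
    case empty
    then show ?case by simp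
  next
    case (insert x C)
    have "A \<union> C \<in> Pfe"
      using A insert.hyps by (simp add: Pfe_def)
    moreover have "A \<rhd> x"
      using insert.prems assms(1) by (simp add: ent_le_def)
    ultimately have "A \<union> C \<rhd> x"
      using ent_superset by blast
    moreover have "A \<union> C \<union> {x} \<rhd> c"
      using insert.prems by simp
    ultimately have "A \<union> C \<rhd> c"
      by (rule ent_cut)
    then show ?case
      using insert by auto
  qed
  moreover have "A \<union> B \<rhd> c"
    using A assms(2,3) by (intro ent_superset[OF assms(3)]) (auto simp: Pfe_def)
  ultimately show ?thesis
    using assms(2) by (auto simp: Pfe_def)
qed

lemma ent_le_refl: "A \<in> Pfe \<Longrightarrow> ent_le ent A A"
  by (simp add: ent_le_def ent_mem)

lemma ent_le_trans: "ent_le ent A B \<Longrightarrow> B \<in> Pfe \<Longrightarrow> ent_le ent B C \<Longrightarrow> ent_le ent A C"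
  using ent_cut_set by (auto simp: ent_le_def)

lemma equiv_ent_eq: "equiv Pfe (ent_eq ent)"
proof (rule equivI)
  show "ent_eq ent \<subseteq> Pfe \<times> Pfe"
    by (auto simp: ent_eq_def)
  show "refl_on Pfe (ent_eq ent)"
    by (auto simp: refl_on_def ent_eq_def ent_le_refl)
  show "sym (ent_eq ent)"
    by (auto simp: sym_def ent_eq_def)
  show "trans (ent_eq ent)"
    by (auto simp: trans_def ent_eq_def intro: ent_le_trans)
qed

lemma Pfe_Un: "A \<in> Pfe \<Longrightarrow> B \<in> Pfe \<Longrightarrow> A \<union> B \<in> Pfe"
  by (auto simp: Pfe_def)

lemma gen_meet_class:
  assumes "A \<in> Pfe" "B \<in> Pfe"
  shows "gen_meet ent (ent_eq ent `` {A}) (ent_eq ent `` {B}) = ent_eq ent `` {A \<union> B}"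
proof -
  have "congruent2 (ent_eq ent) (ent_eq ent) (\<lambda>A B. ent_eq ent `` {A \<union> B})"
  proof (rule congruent2I'[of "ent_eq ent" "ent_eq ent"])
    fix A A' B B' assume *: "(A, A') \<in> ent_eq ent" "(B, B') \<in> ent_eq ent"
    have mem: "A \<union> B \<in> Pfe" "A' \<union> B' \<in> Pfe"
      using * by (auto simp: ent_eq_def intro: Pfe_Un)
    then have "(A \<union> B, A' \<union> B') \<in> ent_eq ent"
      using * ent_superset[OF _ Un_upper1 mem(1)] ent_superset[OF _ Un_upper2 mem(1)]
        ent_superset[OF _ Un_upper1 mem(2)] ent_superset[OF _ Un_upper2 mem(2)]
      by (auto simp: ent_eq_def ent_le_def)
    then show "ent_eq ent `` {A \<union> B} = ent_eq ent `` {A' \<union> B'}"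
      by (rule equiv_class_eq[OF equiv_ent_eq])
  qed
  from UN_equiv_class2[OF equiv_ent_eq equiv_ent_eq this assms] show ?thesis
    by (simp add: gen_meet_def)
qed

lemma class_in_gen: "A \<in> Pfe \<Longrightarrow> ent_eq ent `` {A} \<in> gen_semilattice ent"
  by (simp add: gen_semilattice_def quotientI)

lemma gen_cases:
  assumes "X \<in> gen_semilattice ent"
  obtains A where "A \<in> Pfe" "X = ent_eq ent `` {A}"
  using assms by (auto simp: gen_semilattice_def elim: quotientE)

lemma nat_map_in_gen: "nat_map ent a \<in> gen_semilattice ent"
  by (auto simp: nat_map_def Pfe_def intro: class_in_gen)

lemma gen_meet_closed:
  "X \<in> gen_semilattice ent \<Longrightarrow> Y \<in> gen_semilattice ent \<Longrightarrow>
    gen_meet ent X Y \<in> gen_semilattice ent"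
  by (elim gen_cases) (simp add: gen_meet_class class_in_gen Pfe_Un)

lemma gen_meet_idem: "X \<in> gen_semilattice ent \<Longrightarrow> gen_meet ent X X = X"
  by (elim gen_cases) (simp add: gen_meet_class)

lemma gen_meet_commute:
  "X \<in> gen_semilattice ent \<Longrightarrow> Y \<in> gen_semilattice ent \<Longrightarrow>
    gen_meet ent X Y = gen_meet ent Y X"
  by (elim gen_cases) (simp add: gen_meet_class Un_commute)

lemma gen_meet_assoc:
  "X \<in> gen_semilattice ent \<Longrightarrow> Y \<in> gen_semilattice ent \<Longrightarrow> Z \<in> gen_semilattice ent \<Longrightarrow>
    gen_meet ent (gen_meet ent X Y) Z = gen_meet ent X (gen_meet ent Y Z)"
  by (elim gen_cases) (simp add: gen_meet_class Pfe_Un Un_assoc)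

lemma gen_meet_order:
  assumes "A \<in> Pfe" "B \<in> Pfe"
  shows "gen_meet ent (ent_eq ent `` {A}) (ent_eq ent `` {B}) = ent_eq ent `` {A}
    \<longleftrightarrow> ent_le ent A B"
  using assms ent_mem[of A] ent_mem[OF Pfe_Un[OF assms]]
  unfolding gen_meet_class[OF assms] eq_equiv_class_iff[OF equiv_ent_eq Pfe_Un[OF assms] assms(1)]
  by (auto simp: ent_eq_def ent_le_def Pfe_Un)

theorem gen_semilattice_universal:
  fixes f :: "'a \<Rightarrow> 'l :: semilattice_inf"
  assumes f: "\<And>A b. A \<rhd> b \<Longrightarrow> Inf_fin (f ` A) \<le> f b"
  shows "\<exists>!h. h \<in> extensional (gen_semilattice ent) \<and>
    (\<forall>X\<in>gen_semilattice ent. \<forall>Y\<in>gen_semilattice ent. h (gen_meet ent X Y) = inf (h X) (h Y)) \<and>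
    (\<forall>a. h (nat_map ent a) = f a)"
proof -
  let ?P = "\<lambda>h. h \<in> extensional (gen_semilattice ent) \<and>
    (\<forall>X\<in>gen_semilattice ent. \<forall>Y\<in>gen_semilattice ent. h (gen_meet ent X Y) = inf (h X) (h Y)) \<and>
    (\<forall>a. h (nat_map ent a) = f a)"
  define h where "h = restrict (\<lambda>X. Inf_fin (f ` (SOME A. A \<in> X))) (gen_semilattice ent)"
  have h_ext: "h \<in> extensional (gen_semilattice ent)"
    by (simp add: h_def)
  have le: "Inf_fin (f ` A) \<le> Inf_fin (f ` B)" if "B \<in> Pfe" "ent_le ent A B" for A B
    using that f by (intro Inf_fin.boundedI) (auto simp: Pfe_def ent_le_def)
  have h_class: "h (ent_eq ent `` {A}) = Inf_fin (f ` A)" if A: "A \<in> Pfe" for A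
  proof -
    have "A \<in> ent_eq ent `` {A}"
      using A equiv_class_self[OF equiv_ent_eq] by blast
    then have "(SOME B. B \<in> ent_eq ent `` {A}) \<in> ent_eq ent `` {A}"
      by (rule someI)
    then have "Inf_fin (f ` (SOME B. B \<in> ent_eq ent `` {A})) = Inf_fin (f ` A)"
      by (intro antisym le) (auto simp: ent_eq_def)
    then show ?thesis
      using A by (simp add: h_def class_in_gen)
  qed
  have "h (gen_meet ent X Y) = inf (h X) (h Y)"
    if XY: "X \<in> gen_semilattice ent" "Y \<in> gen_semilattice ent" for X Y
  proof -
    obtain A where A: "A \<in> Pfe" "X = ent_eq ent `` {A}"
      using XY(1) by (rule gen_cases)
    obtain B where B: "B \<in> Pfe" "Y = ent_eq ent `` {B}"
      using XY(2) by (rule gen_cases)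
    note AB = A B
    then have "Inf_fin (f ` (A \<union> B)) = inf (Inf_fin (f ` A)) (Inf_fin (f ` B))"
      unfolding image_Un by (intro Inf_fin.union) (auto simp: Pfe_def)
    then show ?thesis
      using AB by (simp add: gen_meet_class h_class Pfe_Un)
  qed
  moreover have "h (nat_map ent a) = f a" for a
    unfolding nat_map_def by (subst h_class) (auto simp: Pfe_def)
  ultimately have "?P h"
    using h_ext by simp
  moreover have "k = h" if k: "?P k" for k
  proof (rule extensionalityI[of k "gen_semilattice ent"])
    show "k \<in> extensional (gen_semilattice ent)"
      using k by (rule conjunct1)
    show "h \<in> extensional (gen_semilattice ent)"
      by (rule h_ext)
    have k_class: "k (ent_eq ent `` {A}) = Inf_fin (f ` A)" if "finite A" "A \<noteq> {}" for A
      using that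
    proof (induction A rule: finite_ne_induct)
      case (singleton x)
      then show ?case using k by (simp add: nat_map_def)
    next
      case (insert x A)
      have mem: "{x} \<in> Pfe" "A \<in> Pfe"
        using insert.hyps by (auto simp: Pfe_def)
      have "k (ent_eq ent `` {insert x A}) =
          k (gen_meet ent (nat_map ent x) (ent_eq ent `` {A}))"
        using mem by (simp add: nat_map_def gen_meet_class)
      also have "\<dots> = inf (f x) (Inf_fin (f ` A))"
        using k mem insert.IH by (simp add: nat_map_in_gen class_in_gen)
      finally show ?case
        using insert.hyps by simp
    qed
    show "k X = h X" if "X \<in> gen_semilattice ent" for X
      using that k_class h_class by (elim gen_cases) (auto simp: Pfe_def)
  qed
  ultimately show ?thesis
    by (rule ex1I)
qed

end

lemma (in system_of_ideals) nat_map_mono: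
  assumes "a \<le> b"
  shows "gen_meet ent (nat_map ent a) (nat_map ent b) = nat_map ent a"
  using gen_meet_order[of "{a}" "{b}"] ent_order[OF assms]
  by (simp add: nat_map_def Pfe_def ent_le_def)

end

theory Submission
  imports Defs "HOL-Library.Set_Algebras"
begin

text \<open>
  Addition on the quotient is the Minkowski sum of representatives. Equivariance of the
  entailment relation under translations makes the Minkowski sum monotone for the preorder
  on finite sets, hence well defined on classes. The law is unique because every class is a
  finite meet of images of elements of \<open>G\<close> and both laws distribute over meets.
\<close>

lemma Pfe_set_plus: "A \<in> Pfe \<Longrightarrow> B \<in> Pfe \<Longrightarrow> A + B \<in> Pfe"
  by (auto simp: Pfe_def finite_set_plus set_plus_def)

lemma set_plus_Un_distrib: "A + (B \<union> C) = (A + B) \<union> (A + C)"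
  by (auto simp: set_plus_def)

context single_conclusion_entailment
begin

text \<open>The class of a nonempty finite set is the meet of the images of its elements, so the
  image of \<open>nat_map\<close> generates the quotient under \<open>gen_meet\<close>. This reduces
  uniqueness to a check on generators.\<close>

lemma gen_induct [consumes 1, case_names nat_map meet]:
  assumes "X \<in> gen_semilattice ent"
    and nat: "\<And>a. P (nat_map ent a)"
    and meet: "\<And>X Y. X \<in> gen_semilattice ent \<Longrightarrow> Y \<in> gen_semilattice ent \<Longrightarrow>
      P X \<Longrightarrow> P Y \<Longrightarrow> P (gen_meet ent X Y)"
  shows "P X"
proof -
  have "P (ent_eq ent `` {A})" if "finite A" "A \<noteq> {}" for A
    using that
  proof (induction A rule: finite_ne_induct)
    case (singleton a)
    then show ?case using nat by (simp add: nat_map_def)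
  next
    case (insert a A)
    have mem: "{a} \<in> Pfe" "A \<in> Pfe"
      using insert.hyps by (auto simp: Pfe_def)
    have "P (gen_meet ent (nat_map ent a) (ent_eq ent `` {A}))"
      using mem insert.IH nat by (intro meet nat_map_in_gen class_in_gen)
    then show ?case
      using mem by (simp add: nat_map_def gen_meet_class)
  qed
  with assms(1) show ?thesis
    by (elim gen_cases) (auto simp: Pfe_def)
qed

end

context system_of_ideals
begin

text \<open>For \<open>a\<close> in \<open>A'\<close> and \<open>b\<close> in \<open>B\<close>,
  translating the entailment of \<open>a\<close> from \<open>A\<close> by \<open>b\<close> gives an
  entailment of \<open>b + a\<close> from a subset of \<open>A + B\<close>, and weakening enlarges
  it to \<open>A + B\<close>.\<close>

lemma ent_le_set_plus:
  assumes "ent_le ent A A'" "A \<in> Pfe" "B \<in> Pfe"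
  shows "ent_le ent (A + B) (A' + B)"
  unfolding ent_le_def
proof
  fix c assume "c \<in> A' + B"
  then obtain a b where c: "c = b + a" "a \<in> A'" "b \<in> B"
    by (auto simp: set_plus_def add.commute)
  have "(\<lambda>x. b + x) ` A \<rhd> b + a"
    using assms(1) c by (intro ent_translate) (simp add: ent_le_def)
  moreover have "(\<lambda>x. b + x) ` A \<subseteq> A + B"
    using c by (auto simp: add.commute)
  ultimately show "A + B \<rhd> c"
    using assms c ent_superset Pfe_set_plus by blast
qed

text \<open>The summands are replaced one at a time, passing through \<open>A' + B\<close>;
  commutativity of the Minkowski sum reduces the second replacement to the first.\<close>

lemma ent_eq_set_plus:
  assumes "(A, A') \<in> ent_eq ent" "(B, B') \<in> ent_eq ent"
  shows "(A + B, A' + B') \<in> ent_eq ent"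
proof -
  have right: "(A + B, A' + B) \<in> ent_eq ent"
    if "(A, A') \<in> ent_eq ent" "B \<in> Pfe" for A A' B
    using that ent_le_set_plus by (simp add: ent_eq_def Pfe_set_plus)
  have mem: "B \<in> Pfe" "A' \<in> Pfe"
    using assms by (simp_all add: ent_eq_def)
  have "(A' + B, A' + B') \<in> ent_eq ent"
    using right[OF assms(2) mem(2)] by (simp add: add.commute)
  with right[OF assms(1) mem(1)] show ?thesis
    using equiv_ent_eq by (meson equivE transE)
qed

text \<open>The restricted abstractions fix the values outside the carrier, so that uniqueness can
  be an equality of functions. All classes in the union coincide by
  \<open>ent_eq_set_plus\<close>.\<close>

definition gen_add :: "'a set set \<Rightarrow> 'a set set \<Rightarrow> 'a set set" where
  "gen_add = (\<lambda>X\<in>gen_semilattice ent. \<lambda>Y\<in>gen_semilattice ent.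
    \<Union>A\<in>X. \<Union>B\<in>Y. ent_eq ent `` {A + B})"

lemma gen_add_class:
  assumes "A \<in> Pfe" "B \<in> Pfe"
  shows "gen_add (ent_eq ent `` {A}) (ent_eq ent `` {B}) = ent_eq ent `` {A + B}"
proof -
  have "congruent2 (ent_eq ent) (ent_eq ent) (\<lambda>A B. ent_eq ent `` {A + B})"
    by (rule congruent2I') (metis ent_eq_set_plus equiv_class_eq equiv_ent_eq)
  from UN_equiv_class2[OF equiv_ent_eq equiv_ent_eq this assms] show ?thesis
    using assms by (simp add: gen_add_def class_in_gen)
qed

lemma gen_add_closed:
  "X \<in> gen_semilattice ent \<Longrightarrow> Y \<in> gen_semilattice ent \<Longrightarrow>
    gen_add X Y \<in> gen_semilattice ent"
  by (elim gen_cases) (simp add: gen_add_class class_in_gen Pfe_set_plus)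

lemma gen_add_extensional:
  "gen_add \<in> gen_semilattice ent \<rightarrow>\<^sub>E (gen_semilattice ent \<rightarrow>\<^sub>E gen_semilattice ent)"
proof (intro PiE_I)
  fix X Y assume "X \<in> gen_semilattice ent" "Y \<in> gen_semilattice ent"
  then show "gen_add X Y \<in> gen_semilattice ent"
    by (rule gen_add_closed)
qed (simp_all add: gen_add_def)

lemma gen_add_nat_map:
  "gen_add (nat_map ent x) (nat_map ent y) = nat_map ent (x + y)"
  unfolding nat_map_def
  by (subst gen_add_class) (auto simp: Pfe_def set_plus_def)

text \<open>Distributivity holds already for representatives, since the Minkowski sum distributes
  over unions.\<close>

lemma gen_add_meet_distrib:
  "X \<in> gen_semilattice ent \<Longrightarrow> Y \<in> gen_semilattice ent \<Longrightarrow> Z \<in> gen_semilattice ent \<Longrightarrow>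
    gen_add X (gen_meet ent Y Z) = gen_meet ent (gen_add X Y) (gen_add X Z)"
  by (elim gen_cases)
    (simp add: gen_add_class gen_meet_class Pfe_Un Pfe_set_plus set_plus_Un_distrib)

lemma comm_monoid_gen_add:
  "Group.comm_monoid \<lparr>carrier = gen_semilattice ent, mult = gen_add, one = nat_map ent 0\<rparr>"
  (is "Group.comm_monoid ?M")
proof (rule comm_monoidI)
  have zero: "{0} \<in> (Pfe :: 'a set set)"
    by (simp add: Pfe_def)
  have "gen_add (nat_map ent 0) X = X" if "X \<in> gen_semilattice ent" for X
    using that zero
    by (elim gen_cases) (simp add: nat_map_def gen_add_class set_plus_def)
  then show "\<one>\<^bsub>?M\<^esub> \<otimes>\<^bsub>?M\<^esub> X = X" if "X \<in> carrier ?M" for X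
    using that by simp
\<comment> \<open>Associativity and commutativity are inherited from the Minkowski sum of
  representatives.\<close>
qed (auto simp: gen_add_closed nat_map_in_gen gen_add_class Pfe_set_plus ac_simps
    elim!: gen_cases)

lemma gen_add_unique:
  assumes ext: "add \<in> gen_semilattice ent \<rightarrow>\<^sub>E (gen_semilattice ent \<rightarrow>\<^sub>E gen_semilattice ent)"
    and comm: "\<And>X Y. X \<in> gen_semilattice ent \<Longrightarrow> Y \<in> gen_semilattice ent \<Longrightarrow>
      add X Y = add Y X"
    and nat: "\<And>x y. add (nat_map ent x) (nat_map ent y) = nat_map ent (x + y)"
    and distrib: "\<And>X Y Z. X \<in> gen_semilattice ent \<Longrightarrow> Y \<in> gen_semilattice ent \<Longrightarrow>
      Z \<in> gen_semilattice ent \<Longrightarrow>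
      add X (gen_meet ent Y Z) = gen_meet ent (add X Y) (add X Z)"
  shows "add = gen_add"
proof -
  interpret M: Group.comm_monoid
    "\<lparr>carrier = gen_semilattice ent, mult = gen_add, one = nat_map ent 0\<rparr>"
    by (rule comm_monoid_gen_add)
  \<comment> \<open>Distributivity is given in the right argument, so the left one is first held at
    a generator.\<close>
  have nat_left: "add (nat_map ent a) Y = gen_add (nat_map ent a) Y"
    if "Y \<in> gen_semilattice ent" for a Y
    using that
  proof (induction Y rule: gen_induct)
    case (nat_map b)
    show ?case by (simp add: nat gen_add_nat_map)
  next
    case (meet Y Z)
    then show ?case by (simp add: distrib gen_add_meet_distrib nat_map_in_gen)
  qed
  have eq: "add X Y = gen_add X Y"
    if "X \<in> gen_semilattice ent" "Y \<in> gen_semilattice ent" for X Y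
  proof -
    \<comment> \<open>The arguments are swapped so that \<open>X\<close>, which is now decomposed,
      stands where \<open>distrib\<close> applies. At a generator, commutativity leads back to
      \<open>nat_left\<close>.\<close>
    have "add Y X = gen_add Y X"
      using that(1)
    proof (induction X rule: gen_induct)
      case (nat_map a)
      show ?case
        using nat_left[OF that(2)] comm M.m_comm that(2) nat_map_in_gen by simp
    next
      case (meet X Z)
      then show ?case using that(2) by (simp add: distrib gen_add_meet_distrib)
    qed
    then show ?thesis
      using that comm M.m_comm by simp
  qed
  show ?thesis
  \<comment> \<open>Agreement on the carrier gives equality of functions by extensionality, used
    once for each argument of the curried laws.\<close>
  proof (rule PiE_ext[OF ext gen_add_extensional])
    fix X assume X: "X \<in> gen_semilattice ent"
    show "add X = gen_add X"
      by (rule PiE_ext[OF PiE_mem[OF ext X] PiE_mem[OF gen_add_extensional X] eq[OF X]])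
  qed
qed

end

theorem theorem1p10:
  fixes ent :: "'a :: ordered_comm_monoid_add set \<Rightarrow> 'a \<Rightarrow> bool"
    and S :: "'a set set set"
  defines "S \<equiv> gen_semilattice ent"
  assumes "system_of_ideals ent"
  shows "\<exists>!add. add \<in> S \<rightarrow>\<^sub>E (S \<rightarrow>\<^sub>E S) \<and>
    (\<exists>zero. Group.comm_monoid \<lparr>carrier = S, mult = add, one = zero\<rparr> \<and>
      nat_map ent 0 = zero \<and>
      (\<forall>x y. nat_map ent (x + y) = add (nat_map ent x) (nat_map ent y))) \<and>
    (\<forall>x\<in>S. \<forall>y\<in>S. \<forall>z\<in>S.
      add x (gen_meet ent y z) = gen_meet ent (add x y) (add x z))"
proof -
  interpret system_of_ideals ent
    by (rule assms)
  show ?thesis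
    unfolding S_def
  proof (rule ex1I[of _ gen_add], intro conjI exI[of _ "nat_map ent 0"])
    fix add
    let ?S = "gen_semilattice ent"
    assume add: "add \<in> ?S \<rightarrow>\<^sub>E (?S \<rightarrow>\<^sub>E ?S) \<and>
      (\<exists>zero. Group.comm_monoid \<lparr>carrier = ?S, mult = add, one = zero\<rparr> \<and>
        nat_map ent 0 = zero \<and>
        (\<forall>x y. nat_map ent (x + y) = add (nat_map ent x) (nat_map ent y))) \<and>
      (\<forall>x\<in>?S. \<forall>y\<in>?S. \<forall>z\<in>?S.
        add x (gen_meet ent y z) = gen_meet ent (add x y) (add x z))"
    then obtain zero where M: "Group.comm_monoid \<lparr>carrier = ?S, mult = add, one = zero\<rparr>"
      by blast
    show "add = gen_add"
    proof (rule gen_add_unique)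
      show "add X Y = add Y X" if "X \<in> ?S" "Y \<in> ?S" for X Y
        using comm_monoid.m_comm[OF M] that by simp
    qed (use add in auto)
  qed (simp_all add: gen_add_extensional comm_monoid_gen_add gen_add_nat_map
      gen_add_meet_distrib)
qed

end
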